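(* For all $n\geq 0$, $\mathrm{pst}(4n+1)\equiv \mathrm{pst}(4n+2) \pmod 2$.
   Context: For $n\ge1$, $\mathrm{pst}(n)$ denotes the total number of parts (counted with multiplicity) in all the partitions in $\mathcal{ST}(n)$, the set of semi-tribonacci partitions of $n$, defined as follows. A partition of $n$ is a weakly decreasing sequence (equivalently, a finite multiset) of positive integers with sum $n$. $\lambda\sqcup\mu$ is the partition whose multiset of parts is the multiset union (multiplicities added) of the parts of $\lambda$ and $\mu$; $2\lambda$ is obtained by doubling every part; if $\lambda$ has an odd part, $\lambda^{o+2}$ is obtained by adding $2$ to (one occurrence of) the largest odd part of $\lambda$. These operations are applied elementwise to sets of partitions (giving $\emptyset$ for the empty set). $\mathcal{ST}(0)=\emptyset$, $\mathcal{ST}(1)=\{(1)\}$, $\mathcal{ST}(3)=\{(3),(2,1)\}$, and for $n\ge1$: $\mathcal{ST}(2n)=2\,\mathcal{ST}(n)$ and $\mathcal{ST}(2n+3)=\big(\mathcal{ST}(2n+2)\sqcup(1)\big)\cup \mathcal{ST}(2n+1)^{o+2}\cup\big(\mathcal{ST}(2n)\sqcup(1,1,1)\big)$. *)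

theory Defs
  imports Main "HOL-Library.Multiset" "HOL-Number_Theory.Cong"
begin

text \<open>
  Partitions are represented by the finite multisets of their parts, so that
  \<open>\<lambda> \<squnion> \<mu>\<close> is multiset sum and the number of parts, counted with
  multiplicity, is \<^const>\<open>size\<close>.
\<close>

definition is_partition :: "nat \<Rightarrow> nat multiset \<Rightarrow> bool" where
  "is_partition n p \<longleftrightarrow> (\<forall>x \<in># p. x > 0) \<and> sum_mset p = n"

definition double_parts :: "nat multiset \<Rightarrow> nat multiset" where
  "double_parts p = image_mset (\<lambda>x. 2 * x) p"

definition largest_odd_part :: "nat multiset \<Rightarrow> nat" where
  "largest_odd_part p = Max {x. x \<in># p \<and> odd x}"

text \<open>
  The operation that adds 2 to one occurrence of the largest odd part. It is meaningful
  only if \<open>p\<close> has an odd part (otherwise the value of \<^const>\<open>Max\<close> is unspecified); below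
  it is applied only to partitions of odd numbers, see \<open>ST_odd_has_odd_part\<close>.
\<close>

definition raise_odd :: "nat multiset \<Rightarrow> nat multiset" where
  "raise_odd p = (p - {#largest_odd_part p#}) + {#largest_odd_part p + 2#}"

lemma two_times_neq: "2 * n \<noteq> (3::nat)" "2 * n \<noteq> 2 * m + (3::nat)"
  by presburger+

function ST :: "nat \<Rightarrow> nat multiset set" where
  "ST 0 = {}"
| "ST 1 = {{#1#}}"
| "ST 3 = {{#3#}, {#2, 1#}}"
| "n \<ge> 1 \<Longrightarrow> ST (2 * n) = double_parts ` ST n"
| "n \<ge> 1 \<Longrightarrow> ST (2 * n + 3) =
     (\<lambda>p. p + {#1#}) ` ST (2 * n + 2) \<union> raise_odd ` ST (2 * n + 1)
       \<union> (\<lambda>p. p + {#1, 1, 1#}) ` ST (2 * n)"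
  by (atomize_elim, presburger) (simp_all add: two_times_neq)
termination by (relation "measure id") auto

definition pst :: "nat \<Rightarrow> nat" where
  "pst n = (\<Sum>p \<in> ST n. size p)"

lemma finite_ST: "finite (ST n)"
  by (induction n rule: ST.induct) (simp_all only: ST.simps finite_Un finite_imageI finite.intros simp_thms)

lemma odd_part_of_odd_sum:
  assumes "odd (sum_mset p)"
  shows "\<exists>x. x \<in># p \<and> odd (x::nat)"
proof (rule ccontr)
  assume "\<not> ?thesis"
  then have "\<forall>x \<in># p. even x" by blast
  then have "even (sum_mset p)" by (induction p) auto
  with assms show False by simp
qed

lemma is_partition_raise_odd:
  assumes "is_partition n p" "odd n"
  shows "is_partition (n + 2) (raise_odd p)"
proof -
  let ?m = "largest_odd_part p"
  have "{x. x \<in># p \<and> odd x} \<noteq> {}"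
    using assms odd_part_of_odd_sum[of p] by (auto simp: is_partition_def)
  then have "?m \<in> {x. x \<in># p \<and> odd x}"
    unfolding largest_odd_part_def by (intro Max_in) auto
  then obtain q where q: "p = add_mset ?m q"
    by (blast dest: multi_member_split)
  have "p - {#?m#} = q"
    using q by (metis add_mset_remove_trivial)
  then have "raise_odd p = add_mset (?m + 2) q"
    by (simp add: raise_odd_def)
  moreover have "is_partition n (add_mset ?m q)"
    using q assms by simp
  ultimately show ?thesis by (auto simp: is_partition_def)
qed

lemma is_partition_double_parts:
  "is_partition n p \<Longrightarrow> is_partition (2 * n) (double_parts p)"
  by (auto simp: is_partition_def double_parts_def sum_mset_distrib_left[where f = "\<lambda>x. x", simplified])

lemma ST_is_partition: "p \<in> ST n \<Longrightarrow> is_partition n p"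
proof (induction n arbitrary: p rule: ST.induct)
  case (4 n)
  then show ?case
    using is_partition_double_parts by (auto simp only: ST.simps)
next
  case (5 n)
  have "p \<in> (\<lambda>p. p + {#1#}) ` ST (2 * n + 2) \<union> raise_odd ` ST (2 * n + 1)
       \<union> (\<lambda>p. p + {#1, 1, 1#}) ` ST (2 * n)"
    using "5.prems" ST.simps(5)[OF "5.hyps"] by (simp only:)
  then consider
      q where "q \<in> ST (2 * n + 2)" "p = q + {#1#}"
    | q where "q \<in> ST (2 * n + 1)" "p = raise_odd q"
    | q where "q \<in> ST (2 * n)" "p = q + {#1, 1, 1#}"
    by blast
  then show ?case
  proof cases
    case 1
    then show ?thesis using "5.IH"(1)[of q] by (auto simp: is_partition_def)
  next
    case 2
    have "is_partition (2 * n + 1 + 2) p"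
      unfolding 2(2) using "5.IH"(2)[OF 2(1)] by (intro is_partition_raise_odd) simp_all
    then show ?thesis by (simp add: numeral_3_eq_3)
  next
    case 3
    then show ?thesis using "5.IH"(3)[of q] by (auto simp: is_partition_def)
  qed
qed (auto simp: is_partition_def ST.simps(2)[unfolded One_nat_def])

lemma ST_odd_has_odd_part:
  "odd n \<Longrightarrow> p \<in> ST n \<Longrightarrow> \<exists>x. x \<in># p \<and> odd x"
  using ST_is_partition[of p n] odd_part_of_odd_sum[of p] by (simp add: is_partition_def)

end

theory Submission imports Defs begin

text \<open>
  Doubling is injective and keeps the number of parts, so \<open>pst (2 n) = pst n\<close> and
  \<open>card (ST (2 n)) = card (ST n)\<close>; in particular the claim reads
  \<open>pst (4 n + 1) \<equiv> pst (2 n + 1)\<close>.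

  The three sets that make up \<open>ST (2 n + 3)\<close> are pairwise disjoint, because partitions in
  \<open>ST (2 n)\<close> and \<open>ST (2 n + 2)\<close> have only even parts: the odd parts are exactly \<open>(1)\<close> in the
  first set and \<open>(1, 1, 1)\<close> in the third, while a partition of the second set has an odd part
  that is at least 3. Each of the three operations is injective and changes the number of parts
  by 1, 0 and 3 respectively. Since 1 and 3 have the same parity, the weight
  \<open>w n = pst n + card (ST n)\<close> satisfies
  \<open>pst (2 n + 3) \<equiv> pst (2 n + 1) + w (n + 1) + w n\<close> modulo 2.

  Apply this to the step from \<open>4 n + 1\<close> to \<open>4 n + 3\<close> and to the step from \<open>4 n + 3\<close> to
  \<open>4 n + 5\<close>. The increments are \<open>w (2 n + 1) + w (2 n)\<close> and \<open>w (2 n + 2) + w (2 n + 1)\<close>; the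
  middle weight cancels modulo 2, and the even ones reduce to \<open>w n\<close> and \<open>w (n + 1)\<close>. Their sum
  is the increment from \<open>pst (2 n + 1)\<close> to \<open>pst (2 n + 3)\<close>, so both sides of the claim change
  by the same parity when \<open>n\<close> grows by 1.
\<close>

lemma inj_double_parts: "inj double_parts"
  unfolding double_parts_def by (rule injI) (auto dest: multiset.inj_map_strong[rotated])

lemma ST_double: "ST (2 * n) = double_parts ` ST n"
  by (cases "n = 0") (simp_all add: ST.simps(4))

lemma even_part_of_ST_even: "p \<in> ST (2 * n) \<Longrightarrow> x \<in># p \<Longrightarrow> even x"
  by (auto simp: ST_double double_parts_def)

lemma pst_double: "pst (2 * n) = pst n"
proof -
  have "pst (2 * n) = (\<Sum>p\<in>ST n. size (double_parts p))"
    unfolding pst_def ST_double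
    by (simp add: sum.reindex inj_on_subset[OF inj_double_parts])
  then show ?thesis by (simp add: pst_def double_parts_def)
qed

lemma card_ST_double: "card (ST (2 * n)) = card (ST n)"
  unfolding ST_double by (rule card_image) (rule inj_on_subset[OF inj_double_parts], simp)

lemma largest_odd_part_props:
  assumes "\<exists>x. x \<in># p \<and> odd x"
  shows largest_odd_part_mem: "largest_odd_part p \<in># p"
    and odd_largest_odd_part: "odd (largest_odd_part p)"
proof -
  have "largest_odd_part p \<in> {x. x \<in># p \<and> odd x}"
    unfolding largest_odd_part_def using assms by (intro Max_in) auto
  then show "largest_odd_part p \<in># p" "odd (largest_odd_part p)" by auto
qed

lemma largest_odd_part_raise_odd:
  assumes "\<exists>x. x \<in># p \<and> odd x"
  shows "largest_odd_part (raise_odd p) = largest_odd_part p + 2"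
proof -
  let ?m = "largest_odd_part p"
  have le: "x \<le> ?m" if "x \<in># p" "odd x" for x
    unfolding largest_odd_part_def using that by (intro Max_ge) auto
  show ?thesis
    unfolding largest_odd_part_def[of "raise_odd p"]
  proof (rule Max_eqI)
    show "x \<le> ?m + 2" if "x \<in> {x. x \<in># raise_odd p \<and> odd x}" for x
      using that le by (auto simp: raise_odd_def dest!: in_diffD intro: le_SucI)
    show "?m + 2 \<in> {x. x \<in># raise_odd p \<and> odd x}"
      using odd_largest_odd_part[OF assms] by (simp add: raise_odd_def)
  qed simp
qed

text \<open>
  The raised part is still the largest odd one, so it can be located in the result and lowered
  again.
\<close>
lemma lower_raise_odd:
  assumes "\<exists>x. x \<in># p \<and> odd x"
  shows "raise_odd p - {#largest_odd_part (raise_odd p)#}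
           + {#largest_odd_part (raise_odd p) - 2#} = p"
proof -
  have lower: "p - {#m#} + {#m + 2#} - {#m + 2#} + {#m + 2 - 2#} = p" if "m \<in># p" for m
    using that by simp
  show ?thesis
    using lower[OF largest_odd_part_mem[OF assms]]
    by (simp only: largest_odd_part_raise_odd[OF assms] flip: raise_odd_def)
qed

lemma inj_on_raise_odd: "inj_on raise_odd {p. \<exists>x. x \<in># p \<and> odd x}"
  by (rule inj_on_inverseI[where
        g = "\<lambda>q. q - {#largest_odd_part q#} + {#largest_odd_part q - 2#}"])
    (rule lower_raise_odd, rule CollectD)

lemma size_raise_odd:
  assumes "\<exists>x. x \<in># p \<and> odd x"
  shows "size (raise_odd p) = size p"
  using largest_odd_part_mem[OF assms] by (simp add: raise_odd_def size_Suc_Diff1)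

lemma raise_odd_has_large_odd_part:
  assumes "\<exists>x. x \<in># p \<and> odd x"
  shows "\<exists>x. x \<in># raise_odd p \<and> odd x \<and> x \<noteq> 1"
proof -
  have "largest_odd_part p + 2 \<in># raise_odd p" by (simp add: raise_odd_def)
  then show ?thesis using odd_largest_odd_part[OF assms] by (intro exI) auto
qed

text \<open>
  The explicit value of \<open>ST 3\<close> is what the general recursion gives when the exceptional
  \<open>ST 0 = {}\<close> is inserted, so the recurrences below start at \<open>n = 0\<close>.
\<close>
lemma ST_odd_step:
  "ST (2 * n + 3) =
     (\<lambda>p. p + {#1#}) ` ST (2 * n + 2) \<union> raise_odd ` ST (2 * n + 1)
       \<union> (\<lambda>p. p + {#1, 1, 1#}) ` ST (2 * n)"
proof (cases "n = 0")
  case True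
  have "{x. x = Suc 0 \<and> odd x} = {1}" by auto
  then have "largest_odd_part {#1#} = 1"
    by (simp add: largest_odd_part_def)
  then have raise: "raise_odd {#1#} = {#3#}" by (simp add: raise_odd_def)
  have ST2: "ST 2 = {{#2#}}"
    unfolding ST_double[of 1, unfolded mult_1_right] ST.simps(2) by (simp add: double_parts_def)
  have idx: "2 * n + 3 = 3" "2 * n + 2 = 2" "2 * n + 1 = 1" "2 * n = 0"
    using True by simp_all
  have "ST 3 = (\<lambda>p. p + {#1#}) ` ST 2 \<union> raise_odd ` ST 1 \<union> (\<lambda>p. p + {#1, 1, 1#}) ` ST 0"
    unfolding ST.simps(1-3) ST2 image_insert image_empty raise by auto
  then show ?thesis unfolding idx(1-3) unfolding idx(4) .
next
  case False
  then show ?thesis by (intro ST.simps(5)) simp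
qed

text \<open>
  The multiset of odd parts tells the three sets apart: an odd part other than 1 marks the raised
  partitions, and the multiplicity of 1 separates the other two sets. The sizes therefore add
  up, with an extra 1 or 3 for each partition that receives new parts.
\<close>
lemma pst_odd_step:
  "pst (2 * n + 3) =
     pst (2 * n + 1) + (pst (n + 1) + card (ST (n + 1))) + (pst n + 3 * card (ST n))"
proof -
  define A where "A = (\<lambda>p. p + {#1::nat#}) ` ST (2 * n + 2)"
  define B where "B = raise_odd ` ST (2 * n + 1)"
  define C where "C = (\<lambda>p. p + {#1::nat, 1, 1#}) ` ST (2 * n)"
  have two: "2 * n + 2 = 2 * (n + 1)" by simp
  have odd_part: "\<exists>x. x \<in># p \<and> odd x" if "p \<in> ST (2 * n + 1)" for p
    using ST_odd_has_odd_part[OF _ that] by simp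
  have evenA: "even x" if "p \<in> ST (2 * n + 2)" "x \<in># p" for p x
    using that even_part_of_ST_even unfolding two by blast
  have evenC: "even x" if "p \<in> ST (2 * n)" "x \<in># p" for p x
    using that even_part_of_ST_even by blast
  have only1: "x = 1" if "p \<in> A \<union> C" "x \<in># p" "odd x" for p x
    using that evenA evenC by (auto simp: A_def C_def)
  have "\<exists>x. x \<in># p \<and> odd x \<and> x \<noteq> 1" if "p \<in> B" for p
    using that odd_part raise_odd_has_large_odd_part by (auto simp: B_def)
  then have B_disj: "(A \<union> C) \<inter> B = {}" using only1 by blast
  have "count p 1 = 1" if "p \<in> A" for p
    using that evenA[of _ 1] by (auto simp: A_def count_eq_zero_iff)
  moreover have "count p 1 = 3" if "p \<in> C" for p
    using that evenC[of _ 1] by (auto simp: C_def count_eq_zero_iff)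
  ultimately have AC_disj: "A \<inter> C = {}" by fastforce
  have "pst (2 * n + 3) = sum size (A \<union> B \<union> C)"
    by (simp only: pst_def ST_odd_step A_def B_def C_def)
  also have "\<dots> = sum size A + sum size B + sum size C"
  proof -
    have "finite A" "finite B" "finite C" by (simp_all add: A_def B_def C_def finite_ST)
    moreover have "A \<inter> B = {}" "(A \<union> B) \<inter> C = {}" using B_disj AC_disj by blast+
    ultimately show ?thesis by (simp add: sum.union_disjoint)
  qed
  also have "sum size A = pst (n + 1) + card (ST (n + 1))"
  proof -
    have "sum size A = (\<Sum>p\<in>ST (2 * n + 2). size p + 1)"
      by (simp add: A_def sum.reindex inj_on_def)
    also have "\<dots> = pst (2 * n + 2) + card (ST (2 * n + 2))"
      by (simp only: sum.distrib pst_def card_eq_sum)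
    finally show ?thesis by (simp only: two pst_double card_ST_double)
  qed
  also have "sum size B = pst (2 * n + 1)"
  proof -
    have "inj_on raise_odd (ST (2 * n + 1))"
      by (rule inj_on_subset[OF inj_on_raise_odd]) (use odd_part in blast)
    then have "sum size B = (\<Sum>p\<in>ST (2 * n + 1). size (raise_odd p))"
      by (simp add: B_def sum.reindex)
    also have "\<dots> = pst (2 * n + 1)"
      unfolding pst_def by (intro sum.cong refl size_raise_odd odd_part)
    finally show ?thesis .
  qed
  also have "sum size C = pst n + 3 * card (ST n)"
  proof -
    have "sum size C = (\<Sum>p\<in>ST (2 * n). size p + 3)"
      by (simp add: C_def sum.reindex inj_on_def numeral_3_eq_3)
    also have "\<dots> = pst (2 * n) + 3 * card (ST (2 * n))"
      by (simp add: sum.distrib pst_def)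
    finally show ?thesis by (simp only: pst_double card_ST_double)
  qed
  finally show ?thesis by simp
qed

theorem theorem4p7:
  fixes n :: nat
  shows "[pst (4 * n + 1) = pst (4 * n + 2)] (mod 2)"
proof -
  define w where "w n = pst n + card (ST n)" for n
  have w_double: "w (2 * n) = w n" for n
    by (simp only: w_def pst_double card_ST_double)
  have step: "even (pst (2 * n + 3)) = even (pst (2 * n + 1) + w (n + 1) + w n)" for n
    unfolding pst_odd_step w_def by auto
  have "even (pst (4 * n + 1)) = even (pst (2 * n + 1))"
  proof (induction n)
    case 0
    show ?case by simp
  next
    case (Suc n)
    have idx: "2 * (2 * n) + 3 = 4 * n + 3" "2 * (2 * n) + 1 = 4 * n + 1"
      "2 * (2 * n + 1) + 3 = 4 * n + 5" "2 * (2 * n + 1) + 1 = 4 * n + 3"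
      "2 * n + 1 + 1 = 2 * (n + 1)" by simp_all
    have "even (pst (4 * n + 3)) = even (pst (4 * n + 1) + w (2 * n + 1) + w n)"
      using step[of "2 * n"] by (simp only: idx w_double)
    moreover have "even (pst (4 * n + 5)) = even (pst (4 * n + 3) + w (n + 1) + w (2 * n + 1))"
      using step[of "2 * n + 1"] by (simp only: idx w_double)
    (* The weight of 2 n + 1 occurs in both steps and drops out of the parity. *)
    ultimately have "even (pst (4 * n + 5)) = even (pst (2 * n + 3))"
      using Suc.IH step[of n] by auto
    moreover have "4 * Suc n + 1 = 4 * n + 5" "2 * Suc n + 1 = 2 * n + 3" by simp_all
    ultimately show ?case by (simp only:)
  qed
  moreover have "pst (4 * n + 2) = pst (2 * n + 1)"
    using pst_double[of "2 * n + 1"] by simp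
  ultimately show ?thesis
    by (simp add: cong_def mod2_eq_if)
qed

end
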